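(* Let $\mathcal F\subseteq 2^{[n]}$ be induced $2C_2$-saturating. Then $\mathcal F$ contains a maximal chain of $2^{[n]}$, i.e., sets $\emptyset=A_0\subsetneq A_1\subsetneq\dots\subsetneq A_n=[n]$ with $|A_j|=j$. In particular, $\mathrm{sat}^*(n,2C_2)\ge n+2$ for every $n\ge 2$.
   Context: $2C_2$ is the poset on four elements $a<b$, $c<d$ with no other relations. A subfamily $\mathcal G\subseteq\mathcal F\subseteq 2^{[n]}$ is an induced copy of a poset $P$ if there is a bijection $i:P\to\mathcal G$ with $p\le_P q$ iff $i(p)\subseteq i(q)$; $\mathcal F$ is induced $P$-saturating if it has no induced copy of $P$ and adding any $G\in2^{[n]}\setminus\mathcal F$ creates one. $\mathrm{sat}^*(n,P)$ is the minimum size of an induced $P$-saturating family in $2^{[n]}$. *)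

theory Defs
  imports Main
begin

text \<open>A poset is given by its reflexive order relation \<open>r\<close>, with carrier \<open>Field r\<close>; the ground set is
  \<open>[n] = {1..n}\<close>.\<close>

definition induced_copy :: "'p rel \<Rightarrow> 'a set set \<Rightarrow> bool" where
  "induced_copy r \<G> \<longleftrightarrow>
     (\<exists>i. bij_betw i (Field r) \<G> \<and>
          (\<forall>p\<in>Field r. \<forall>q\<in>Field r. (p, q) \<in> r \<longleftrightarrow> i p \<subseteq> i q))"

definition contains_induced_copy :: "'p rel \<Rightarrow> 'a set set \<Rightarrow> bool" where
  "contains_induced_copy r \<F> \<longleftrightarrow> (\<exists>\<G>\<subseteq>\<F>. induced_copy r \<G>)"

definition induced_saturating :: "nat \<Rightarrow> 'p rel \<Rightarrow> nat set set \<Rightarrow> bool" where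
  "induced_saturating n r \<F> \<longleftrightarrow>
     \<F> \<subseteq> Pow {1..n} \<and> \<not> contains_induced_copy r \<F> \<and>
     (\<forall>G \<in> Pow {1..n} - \<F>. contains_induced_copy r (insert G \<F>))"

text \<open>\<open>Min\<close> is only meaningful on nonempty finite sets; see \<open>sat_star_attained\<close> below.\<close>

definition sat_star :: "nat \<Rightarrow> 'p rel \<Rightarrow> nat" where
  "sat_star n r = Min {card \<F> | \<F>. induced_saturating n r \<F>}"

datatype two_C2_point = a | b | c | d

definition two_C2 :: "two_C2_point rel" where
  "two_C2 = Id \<union> {(a, b), (c, d)}"

hide_const (open) a b c d

lemma Field_two_C2 [simp]: "Field two_C2 = UNIV"
  by (auto simp: two_C2_def Field_def)

lemma Partial_order_two_C2: "Partial_order two_C2"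
  by (auto simp: two_C2_def partial_order_on_def preorder_on_def refl_on_def trans_def
      antisym_def Field_def)

lemma finite_induced_saturating: "finite {\<F>. induced_saturating n r \<F>}"
  by (rule finite_subset[of _ "Pow (Pow {1..n})"]) (auto simp: induced_saturating_def)

lemma induced_saturating_exists:
  assumes "r \<noteq> {}"
  shows "\<exists>\<F>. induced_saturating n r \<F>"
proof -
  let ?S = "{\<F>. \<F> \<subseteq> Pow {1..n} \<and> \<not> contains_induced_copy r \<F>}"
  have "Field r \<noteq> {}"
    using assms by (force intro: FieldI1)
  then have "{} \<in> ?S"
    by (auto simp: contains_induced_copy_def induced_copy_def bij_betw_def)
  moreover have "finite ?S"
    by (rule finite_subset[of _ "Pow (Pow {1..n})"]) auto
  ultimately have "\<exists>M\<in>?S. \<forall>\<F>\<in>?S. M \<subseteq> \<F> \<longrightarrow> M = \<F>"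
    by (metis (no_types, lifting) empty_iff finite_has_maximal)
  then obtain M where M: "M \<in> ?S" and max: "\<forall>\<F>\<in>?S. M \<subseteq> \<F> \<longrightarrow> M = \<F>" ..
  have "contains_induced_copy r (insert G M)" if G: "G \<in> Pow {1..n} - M" for G
  proof (rule ccontr)
    assume "\<not> contains_induced_copy r (insert G M)"
    then have "insert G M \<in> ?S"
      using M G by simp
    then have "M = insert G M"
      by (rule bspec[OF max, THEN mp, OF _ subset_insertI])
    then show False
      using G by auto
  qed
  then show ?thesis
    using M by (auto simp: induced_saturating_def)
qed

lemma sat_star_attained:
  assumes "r \<noteq> {}"
  shows "\<exists>\<F>. induced_saturating n r \<F> \<and> card \<F> = sat_star n r"
proof -
  have "finite {card \<F> | \<F>. induced_saturating n r \<F>}"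
    using finite_induced_saturating[of n r] by simp
  moreover have "{card \<F> | \<F>. induced_saturating n r \<F>} \<noteq> {}"
    using induced_saturating_exists[OF assms, of n] by blast
  ultimately have "sat_star n r \<in> {card \<F> | \<F>. induced_saturating n r \<F>}"
    unfolding sat_star_def by (rule Min_in)
  then show ?thesis
    by auto
qed

end

theory Submission imports Defs begin

text \<open>In a family \<open>\<F>\<close> without induced \<open>2C\<^sub>2\<close> the strict down-sets \<open>{C \<in> \<F>. C \<subset> D}\<close> are
  linearly ordered by inclusion. Call \<open>X\<close> a cut if \<open>C \<subseteq> X\<close> or \<open>X \<subseteq> D\<close> whenever \<open>C \<subset> D\<close> in \<open>\<F>\<close>.
  A cut is comparable to a member of every two-element chain of \<open>\<F>\<close>, so adding it creates no copy of
  \<open>2C\<^sub>2\<close>, and saturation puts all cuts into \<open>\<F>\<close>. Every cut \<open>X \<noteq> [n]\<close> extends to a cut by a single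
  element: otherwise each \<open>z \<notin> X\<close> has a witness \<open>C\<^sub>z \<subset> D\<^sub>z\<close> in \<open>\<F>\<close> with \<open>z \<notin> D\<^sub>z\<close> and \<open>C\<^sub>z\<close> not
  contained in \<open>X\<close>; choosing \<open>x\<close> such that the strict down-set of \<open>D\<^sub>x\<close> is smallest, \<open>C\<^sub>x\<close> lies in all
  \<open>D\<^sub>z\<close> and hence in \<open>X\<close>. Starting from the cut \<open>\<emptyset>\<close> this produces the maximal chain. For the bound,
  a chain \<open>\<F>\<close> is not saturating when \<open>n \<ge> 2\<close>.\<close>

text \<open>The other non-inclusions come for free: \<open>A \<subseteq> C\<close>,
  \<open>B \<subseteq> C\<close> or \<open>B \<subseteq> D\<close> would each force
  \<open>A \<subseteq> D\<close>, and symmetrically.\<close>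

lemma contains_induced_copy_two_C2_iff:
  "contains_induced_copy two_C2 \<F> \<longleftrightarrow>
     (\<exists>A\<in>\<F>. \<exists>B\<in>\<F>. \<exists>C\<in>\<F>. \<exists>D\<in>\<F>. A \<subset> B \<and> C \<subset> D \<and> \<not> A \<subseteq> D \<and> \<not> C \<subseteq> B)"
  (is "?L \<longleftrightarrow> ?R")
proof
  assume ?L
  then obtain \<G> i where "\<G> \<subseteq> \<F>" and bij: "bij_betw i UNIV \<G>"
    and i: "\<And>p q. (p, q) \<in> two_C2 \<longleftrightarrow> i p \<subseteq> i q"
    by (auto simp: contains_induced_copy_def induced_copy_def)
  then have in_F: "i p \<in> \<F>" for p
    by (auto simp: bij_betw_def)
  have "i two_C2_point.a \<subset> i two_C2_point.b" "i two_C2_point.c \<subset> i two_C2_point.d"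
    "\<not> i two_C2_point.a \<subseteq> i two_C2_point.d" "\<not> i two_C2_point.c \<subseteq> i two_C2_point.b"
    unfolding less_le_not_le i[symmetric] by (simp_all add: two_C2_def)
  then show ?R
    using in_F by blast
next
  assume ?R
  then obtain A B C D where ABCD: "A \<in> \<F>" "B \<in> \<F>" "C \<in> \<F>" "D \<in> \<F>"
    "A \<subset> B" "C \<subset> D" "\<not> A \<subseteq> D" "\<not> C \<subseteq> B"
    by blast
  define i where "i = case_two_C2_point A B C D"
  have le: "(p, q) \<in> two_C2 \<longleftrightarrow> i p \<subseteq> i q" for p q
    using ABCD(5-) by (cases p; cases q) (auto simp: two_C2_def i_def)
  then have "inj i"
    using Partial_order_two_C2 by (intro injI) (auto simp: partial_order_on_def antisym_def)
  moreover have "range i \<subseteq> \<F>"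
    using ABCD by (auto simp: i_def split: two_C2_point.splits)
  ultimately show ?L
    using le by (auto simp: contains_induced_copy_def induced_copy_def bij_betw_def)
qed

definition cut :: "'a set set \<Rightarrow> 'a set \<Rightarrow> bool" where
  "cut \<F> X \<longleftrightarrow> (\<forall>C\<in>\<F>. \<forall>D\<in>\<F>. C \<subset> D \<longrightarrow> C \<subseteq> X \<or> X \<subseteq> D)"

lemma cut_in_induced_saturating:
  assumes sat: "induced_saturating n two_C2 \<F>" and X: "cut \<F> X" "X \<subseteq> {1..n}"
  shows "X \<in> \<F>"
proof (rule ccontr)
  assume "X \<notin> \<F>"
  then have "contains_induced_copy two_C2 (insert X \<F>)"
    and free: "\<not> contains_induced_copy two_C2 \<F>"
    using sat X(2) by (auto simp: induced_saturating_def)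
  then obtain A B C D where *: "A \<in> insert X \<F>" "B \<in> insert X \<F>" "C \<in> insert X \<F>" "D \<in> insert X \<F>"
    "A \<subset> B" "C \<subset> D" "\<not> A \<subseteq> D" "\<not> C \<subseteq> B"
    unfolding contains_induced_copy_two_C2_iff by blast
  then have "X \<in> {A, B, C, D}"
    using free unfolding contains_induced_copy_two_C2_iff by blast
  \<comment> \<open>The four sets are distinct, so \<open>C\<close> and \<open>D\<close> lie in
    \<open>\<F>\<close>; the cut then gives \<open>C \<subseteq> X\<close> or
    \<open>X \<subseteq> D\<close>, hence \<open>C \<subseteq> B\<close> or
    \<open>A \<subseteq> D\<close>.\<close>
  moreover have "X \<notin> {A, B}"
  proof
    assume "X \<in> {A, B}"
    moreover have "C \<in> \<F>" "D \<in> \<F>"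
      using * \<open>X \<in> {A, B}\<close> by blast+
    ultimately show False
      using X(1) * unfolding cut_def by blast
  qed
  moreover have "X \<notin> {C, D}"
  proof
    assume "X \<in> {C, D}"
    moreover have "A \<in> \<F>" "B \<in> \<F>"
      using * \<open>X \<in> {C, D}\<close> by blast+
    ultimately show False
      using X(1) * unfolding cut_def by blast
  qed
  ultimately show False
    by blast
qed

lemma strict_down_sets_linear:
  assumes "\<not> contains_induced_copy two_C2 \<F>" "D \<in> \<F>" "E \<in> \<F>"
  shows "{C\<in>\<F>. C \<subset> D} \<subseteq> {C\<in>\<F>. C \<subset> E} \<or> {C\<in>\<F>. C \<subset> E} \<subseteq> {C\<in>\<F>. C \<subset> D}"
proof (rule ccontr)
  assume "\<not> ?thesis"
  then obtain A B where "A \<in> \<F>" "A \<subset> D" "\<not> A \<subset> E" "B \<in> \<F>" "B \<subset> E" "\<not> B \<subset> D"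
    by blast
  \<comment> \<open>Equality is excluded too: \<open>A = E\<close> would give
    \<open>B \<subset> A \<subset> D\<close>, and likewise for \<open>B = D\<close>.\<close>
  moreover from this have "\<not> A \<subseteq> E" "\<not> B \<subseteq> D"
    by blast+
  ultimately show False
    using assms unfolding contains_induced_copy_two_C2_iff by blast
qed

lemma cut_extend:
  assumes free: "\<not> contains_induced_copy two_C2 \<F>" and fin: "finite \<F>" and \<F>: "\<F> \<subseteq> Pow V"
    and X: "cut \<F> X" "X \<subset> V"
  obtains x where "x \<in> V - X" "cut \<F> (insert x X)"
proof (rule ccontr)
  assume "\<not> thesis"
  then have "\<forall>z\<in>V - X. \<exists>C D. C \<in> \<F> \<and> D \<in> \<F> \<and> C \<subset> D \<and> \<not> C \<subseteq> insert z X \<and> \<not> insert z X \<subseteq> D"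
    using that unfolding cut_def by metis
  then obtain c d where cd: "\<And>z. z \<in> V - X \<Longrightarrow>
      c z \<in> \<F> \<and> d z \<in> \<F> \<and> c z \<subset> d z \<and> \<not> c z \<subseteq> insert z X \<and> \<not> insert z X \<subseteq> d z"
    by metis
  \<comment> \<open>As \<open>c z\<close> is not contained in \<open>X\<close>, the cut gives
    \<open>X \<subseteq> d z\<close>, so only \<open>z\<close> itself can be missing from
    \<open>d z\<close>.\<close>
  have d: "z \<notin> d z" if "z \<in> V - X" for z
    using cd[OF that] X(1) unfolding cut_def by blast
  define h where "h z = card {C\<in>\<F>. C \<subset> d z}" for z
  obtain x where x: "x \<in> V - X" and min: "\<And>z. z \<in> V - X \<Longrightarrow> h x \<le> h z"
    using ex_has_least_nat[of "\<lambda>z. z \<in> V - X" _ h] X(2) by blast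
  have "c x \<subset> d z" if z: "z \<in> V - X" for z
  proof -
    \<comment> \<open>The two down-sets are comparable and finite, so least cardinality means least
      under inclusion.\<close>
    have "{C\<in>\<F>. C \<subset> d x} \<subseteq> {C\<in>\<F>. C \<subset> d z}"
    proof (rule disjE[OF strict_down_sets_linear[OF free]])
      assume "{C\<in>\<F>. C \<subset> d z} \<subseteq> {C\<in>\<F>. C \<subset> d x}"
      then show ?thesis
        using card_seteq[of "{C\<in>\<F>. C \<subset> d x}" "{C\<in>\<F>. C \<subset> d z}"] min[OF z] fin
        unfolding h_def by simp
    qed (use cd x z in auto)
    moreover have "c x \<in> {C\<in>\<F>. C \<subset> d x}"
      using cd[OF x] by simp
    ultimately have "c x \<in> {C\<in>\<F>. C \<subset> d z}"
      by (rule subsetD)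
    then show ?thesis
      by simp
  qed
  then have "z \<notin> c x" if "z \<in> V - X" for z
    using d that by blast
  moreover have "c x \<subseteq> V"
    using cd[OF x] \<F> by blast
  ultimately have "c x \<subseteq> X"
    by blast
  then show False
    using cd[OF x] by blast
qed

lemma induced_saturating_two_C2_maximal_chain:
  assumes sat: "induced_saturating n two_C2 \<F>"
  shows "\<exists>A. A 0 = {} \<and> A n = {1..n} \<and> (\<forall>j<n. A j \<subset> A (Suc j)) \<and>
    (\<forall>j\<le>n. card (A j) = j) \<and> (\<forall>j\<le>n. A j \<in> \<F>)"
proof -
  have free: "\<not> contains_induced_copy two_C2 \<F>" and \<F>: "\<F> \<subseteq> Pow {1..n}"
    using sat by (auto simp: induced_saturating_def)
  have fin: "finite \<F>"
    using \<F> finite_subset by blast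
  \<comment> \<open>Trivially true beyond \<open>n\<close>, because dependent choice builds an
    infinite sequence.\<close>
  define P where "P j X \<longleftrightarrow> (j \<le> n \<longrightarrow> cut \<F> X \<and> X \<subseteq> {1..n} \<and> card X = j)" for j X
  have "\<exists>A. \<forall>j. P j (A j) \<and> (j < n \<longrightarrow> A j \<subset> A (Suc j))"
  proof (rule dependent_nat_choice)
    show "\<exists>X. P 0 X"
      by (rule exI[of _ "{}"]) (simp add: P_def cut_def)
  next
    fix X j assume P: "P j X"
    show "\<exists>Y. P (Suc j) Y \<and> (j < n \<longrightarrow> X \<subset> Y)"
    proof (cases "j < n")
      case True
      then have X: "cut \<F> X" "X \<subseteq> {1..n}" "card X = j"
        using P by (auto simp: P_def)
      moreover from this True have "X \<subset> {1..n}"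
        by auto
      ultimately obtain x where "x \<in> {1..n} - X" "cut \<F> (insert x X)"
        using cut_extend[OF free fin \<F>] by blast
      then show ?thesis
        using X finite_subset[OF X(2)] by (intro exI[of _ "insert x X"]) (auto simp: P_def)
    qed (auto simp: P_def)
  qed
  then obtain A where A: "\<And>j. P j (A j)" and less: "\<And>j. j < n \<Longrightarrow> A j \<subset> A (Suc j)"
    by blast
  have sub: "A j \<subseteq> {1..n}" and card: "card (A j) = j" and in_F: "A j \<in> \<F>" if "j \<le> n" for j
    using A[of j] that cut_in_induced_saturating[OF sat] by (auto simp: P_def)
  have "A 0 = {}"
    using card[of 0] finite_subset[OF sub[of 0]] by simp
  moreover have "A n = {1..n}"
    using card_subset_eq[OF _ sub[of n]] card[of n] by simp
  ultimately show ?thesis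
    using less card in_F by blast
qed

lemma chain_not_induced_saturating_two_C2:
  assumes chain: "\<And>A B. A \<in> \<F> \<Longrightarrow> B \<in> \<F> \<Longrightarrow> A \<subseteq> B \<or> B \<subseteq> A" and n: "n \<ge> 2"
  shows "\<not> induced_saturating n two_C2 \<F>"
proof
  assume sat: "induced_saturating n two_C2 \<F>"
  have "{1} \<notin> \<F> \<or> {2} \<notin> \<F>"
    using chain[of "{1}" "{2}"] by auto
  moreover have "{1} \<in> Pow {1..n}" "{2} \<in> Pow {1..n}"
    using n by auto
  ultimately obtain G where "G \<in> Pow {1..n} - \<F>"
    by blast
  then have "contains_induced_copy two_C2 (insert G \<F>)"
    using sat by (auto simp: induced_saturating_def)
  then obtain A B C D where *: "A \<in> insert G \<F>" "B \<in> insert G \<F>" "C \<in> insert G \<F>" "D \<in> insert G \<F>"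
    "A \<subset> B" "C \<subset> D" "\<not> A \<subseteq> D" "\<not> C \<subseteq> B"
    unfolding contains_induced_copy_two_C2_iff by blast
  \<comment> \<open>Each pair is incomparable and so cannot lie inside the chain
    \<open>\<F>\<close>; but no one of four distinct sets belongs to all these pairs.\<close>
  have "G \<in> {A, C}" "G \<in> {B, D}"
    using * chain[of A C] chain[of B D] by blast+
  moreover have "G \<in> {A, D}" "G \<in> {B, C}"
    using * chain[of A D] chain[of B C] by blast+
  ultimately show False
    using * by blast
qed

lemma card_induced_saturating_two_C2:
  assumes sat: "induced_saturating n two_C2 \<F>" and n: "n \<ge> 2"
  shows "n + 2 \<le> card \<F>"
proof -
  obtain A where less: "\<And>j. j < n \<Longrightarrow> A j \<subset> A (Suc j)"
    and card: "\<And>j. j \<le> n \<Longrightarrow> card (A j) = j" and in_F: "\<And>j. j \<le> n \<Longrightarrow> A j \<in> \<F>"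
    using induced_saturating_two_C2_maximal_chain[OF sat] by blast
  have mono: "A i \<subseteq> A j" if "i \<le> j" "j \<le> n" for i j
    using that
  proof (induction j rule: dec_induct)
    case (step k)
    then show ?case
      using less[of k] by auto
  qed simp
  have "A i \<subseteq> A j \<or> A j \<subseteq> A i" if "i \<le> n" "j \<le> n" for i j
    using that mono nat_le_linear by metis
  \<comment> \<open>The \<open>n + 1\<close> sets of the chain cannot be all of \<open>\<F>\<close>,
    which yields one more member.\<close>
  then have "\<not> induced_saturating n two_C2 (A ` {..n})"
    using n by (intro chain_not_induced_saturating_two_C2) auto
  then have "A ` {..n} \<subset> \<F>"
    using sat in_F by auto
  moreover have "finite \<F>"
    using sat finite_subset[of \<F> "Pow {1..n}"] by (auto simp: induced_saturating_def)
  ultimately have "card (A ` {..n}) < card \<F>"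
    by (simp add: psubset_card_mono)
  moreover have "inj_on A {..n}"
    using card by (metis atMost_iff inj_onI)
  ultimately show ?thesis
    by (simp add: card_image)
qed

theorem theorem21:
  fixes n :: nat
  shows "(\<forall>\<F>. induced_saturating n two_C2 \<F> \<longrightarrow>
            (\<exists>A :: nat \<Rightarrow> nat set.
               A 0 = {} \<and> A n = {1..n} \<and>
               (\<forall>j<n. A j \<subset> A (Suc j)) \<and>
               (\<forall>j\<le>n. card (A j) = j) \<and>
               (\<forall>j\<le>n. A j \<in> \<F>))) \<and>
         (n \<ge> 2 \<longrightarrow> sat_star n two_C2 \<ge> n + 2)"
proof (intro conjI allI impI)
  fix \<F> assume "induced_saturating n two_C2 \<F>"
  then show "\<exists>A :: nat \<Rightarrow> nat set. A 0 = {} \<and> A n = {1..n} \<and> (\<forall>j<n. A j \<subset> A (Suc j)) \<and>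
      (\<forall>j\<le>n. card (A j) = j) \<and> (\<forall>j\<le>n. A j \<in> \<F>)"
    by (rule induced_saturating_two_C2_maximal_chain)
next
  assume "n \<ge> 2"
  \<comment> \<open>Ensures that the minimum is attained by some family, to which the bound
    applies.\<close>
  have "two_C2 \<noteq> {}"
    by (auto simp: two_C2_def)
  from sat_star_attained[OF this, of n] show "sat_star n two_C2 \<ge> n + 2"
    using card_induced_saturating_two_C2 \<open>n \<ge> 2\<close> by metis
qed

end
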